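(* Let $X$ be a Hilbert space and let $T:X\rightrightarrows X$ be a proper, globally hypomonotone set-valued mapping whose graph is closed in $X\times X$. Then the following assertions are equivalent: (i) $T$ is maximal monotone on $X$. (ii) $T$ is locally maximal monotone around any point of its graph.
   Context: $X$ is a real Hilbert space with inner product $\langle\cdot,\cdot\rangle$ and norm $\|\cdot\|$, identified with its dual; $X\times X$ carries the product norm topology. A set-valued mapping $T:X\rightrightarrows X$ assigns to each $x\in X$ a (possibly empty) subset $T(x)\subset X$; its graph is $\operatorname{gph}T:=\{(x,x^* ) : x^*\in T(x)\}$. $T$ is proper if $\operatorname{gph}T\ne\emptyset$. $T$ is (globally) hypomonotone if there exists $r>0$ such that $\langle y_1-y_2,x_1-x_2\rangle\ge -r\|x_1-x_2\|^2$ for all $(x_1,y_1),(x_2,y_2)\in\operatorname{gph}T$. $T$ is monotone on $X$ if $\langle x^*-y^*,x-y\rangle\ge 0$ for all $(x,x^* ),(y,y^* )\in\operatorname{gph}T$. $T$ is maximal monotone on $X$ if it is monotone and $\operatorname{gph}T=\operatorname{gph}S$ for every monotone mapping $S:X\rightrightarrows X$ with $\operatorname{gph}T\subset\operatorname{gph}S$. $T$ is locally maximal monotone around $(u,u^* )\in\operatorname{gph}T$ if there exist a maximal monotone mapping $\overline{T}:X\rightrightarrows X$ and a neighborhood $W\subset X\times X$ of $(u,u^* )$ such that $\operatorname{gph}\overline{T}\cap W=\operatorname{gph}T\cap W$. *)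

theory Defs
  imports "HOL-Analysis.Analysis"
begin

text \<open>
  A set-valued mapping on \<open>X\<close> is a function \<open>'a \<Rightarrow> 'a set\<close>; a real Hilbert space is a type of sort
  \<open>{real_inner, complete_space}\<close>. The instance topology on \<open>'a \<times> 'a\<close> is the product norm topology.
\<close>

definition gph :: "('a \<Rightarrow> 'b set) \<Rightarrow> ('a \<times> 'b) set"
  where "gph T = {(x, y). y \<in> T x}"

definition proper_mapping :: "('a \<Rightarrow> 'b set) \<Rightarrow> bool"
  where "proper_mapping T \<longleftrightarrow> gph T \<noteq> {}"

definition hypomonotone :: "('a::real_inner \<Rightarrow> 'a set) \<Rightarrow> bool"
  where "hypomonotone T \<longleftrightarrow>
    (\<exists>r>0. \<forall>(x1, y1) \<in> gph T. \<forall>(x2, y2) \<in> gph T.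
      (y1 - y2) \<bullet> (x1 - x2) \<ge> - r * (norm (x1 - x2))\<^sup>2)"

definition monotone_mapping :: "('a::real_inner \<Rightarrow> 'a set) \<Rightarrow> bool"
  where "monotone_mapping T \<longleftrightarrow>
    (\<forall>(x, x') \<in> gph T. \<forall>(y, y') \<in> gph T. (x' - y') \<bullet> (x - y) \<ge> 0)"

definition maximal_monotone :: "('a::real_inner \<Rightarrow> 'a set) \<Rightarrow> bool"
  where "maximal_monotone T \<longleftrightarrow>
    monotone_mapping T \<and> (\<forall>S. monotone_mapping S \<and> gph T \<subseteq> gph S \<longrightarrow> gph T = gph S)"

text \<open>A neighbourhood of a point is a set, not necessarily open, having the point in its interior.\<close>

definition locally_maximal_monotone_around ::
    "('a::real_inner \<Rightarrow> 'a set) \<Rightarrow> 'a \<times> 'a \<Rightarrow> bool"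
  where "locally_maximal_monotone_around T p \<longleftrightarrow>
    p \<in> gph T \<and>
    (\<exists>Tbar W. maximal_monotone Tbar \<and> p \<in> interior W \<and> gph Tbar \<inter> W = gph T \<inter> W)"

end

theory Submission
  imports Defs
begin

text \<open>
  Only the passage from local to global maximality needs an argument. Hypomonotonicity with
  constant \<open>r\<close> makes \<open>z = l x + y\<close>, for a fixed \<open>l > r\<close>, a good coordinate on the graph of \<open>T\<close>:
  a graph point \<open>(x, y)\<close> is a Lipschitz function of \<open>z\<close>. Hence, the space being complete, the set
  \<open>R\<close> of all such \<open>z\<close> is closed because the graph is. Near a point of the
  graph, \<open>T\<close> agrees with a maximal monotone mapping, for which by Minty's theorem every \<open>z\<close> is attained; since its resolvent is Lipschitz,
  all \<open>z\<close> close to a given point of \<open>R\<close> are attained at graph points close to the given one, so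
  \<open>R\<close> is open. The space is connected and \<open>R\<close> is not empty, so \<open>R\<close> is everything.

  It remains to globalise monotonicity. For two graph points the inequality of monotonicity
  says exactly that the Cayley transform \<open>l x + y \<mapsto> l x - y\<close> does not increase their distance. Now
  that the Cayley transform is defined on the whole space, it is nonexpansive near every point,
  and therefore nonexpansive along every segment. So \<open>T\<close> is monotone, and since
  \<open>l x + y\<close> takes all values, \<open>T\<close> has no proper monotone extension.

  Minty's theorem is obtained by minimising the sum of the Fitzpatrick function of the graph and
  half the square of the norm. This function is strongly convex, so that minimising
  sequences are Cauchy and completeness yields the minimiser.
\<close>

section \<open>Minimising a convex function plus half the squared norm\<close>

lemma norm_sq_convex_combination:
  fixes p q :: "'h::real_inner"
  shows "(norm ((1 - u) *\<^sub>R p + u *\<^sub>R q))\<^sup>2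
    = (1 - u) * (norm p)\<^sup>2 + u * (norm q)\<^sup>2 - u * (1 - u) * (norm (q - p))\<^sup>2"
  unfolding power2_norm_eq_inner
  by (simp add: inner_add_left inner_add_right inner_diff_left inner_diff_right inner_commute[of q p])
     (simp add: algebra_simps)

text \<open>
  The convex function is given by its epigraph \<open>E\<close>, which avoids infinite values. The objective is
  strongly convex, so the minimising sequences are Cauchy, and its growth away from the minimiser
  is at least that of half the squared distance: this is the optimality condition in
  subgradient form.
\<close>

lemma proximal_minimiser_exists:
  fixes E :: "('h::{real_inner, complete_space} \<times> real) set"
  assumes "closed E" "convex E" "E \<noteq> {}"
    and lower: "\<And>q t. (q, t) \<in> E \<Longrightarrow> b \<le> t + (norm q)\<^sup>2 / 2"
  obtains p s where "(p, s) \<in> E"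
    and "\<And>q t. (q, t) \<in> E \<Longrightarrow> s + (norm p)\<^sup>2 / 2 + (norm (q - p))\<^sup>2 / 2 \<le> t + (norm q)\<^sup>2 / 2"
proof -
  define V where "V = (\<lambda>e::'h \<times> real. snd e + (norm (fst e))\<^sup>2 / 2)"
  define m where "m = Inf (V ` E)"
  have bdd: "bdd_below (V ` E)"
    using lower unfolding V_def bdd_below_def by (metis (no_types, lifting) imageE prod.collapse)
  have m_le: "m \<le> V e" if "e \<in> E" for e
    unfolding m_def using bdd that by (simp add: cInf_lower)
  have V_comb: "V ((1 - u) *\<^sub>R e + u *\<^sub>R e')
      = (1 - u) * V e + u * V e' - u * (1 - u) * (norm (fst e' - fst e))\<^sup>2 / 2" for u e e'
    unfolding V_def fst_add snd_add fst_scaleR snd_scaleR norm_sq_convex_combination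
    by (simp add: field_simps)
  have comb_in: "(1 - u) *\<^sub>R e + u *\<^sub>R e' \<in> E" if "e \<in> E" "e' \<in> E" "0 \<le> u" "u \<le> 1" for u e e'
    using \<open>convex E\<close> that unfolding convex_alt by blast
  have "\<exists>e. e \<in> E \<and> V e < m + inverse (real (Suc n))" for n
  proof -
    have "Inf (V ` E) < m + inverse (real (Suc n))" by (simp add: m_def)
    then show ?thesis
      using cInf_lessD[of "V ` E"] \<open>E \<noteq> {}\<close> by blast
  qed
  then obtain e where eE: "\<And>n. e n \<in> E" and eV: "\<And>n. V (e n) < m + inverse (real (Suc n))"
    by metis
  have dist_sq: "(norm (fst (e j) - fst (e i)))\<^sup>2 \<le> 8 * inverse (real (Suc N))"
    if "N \<le> i" "N \<le> j" for N i j
  proof -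
    have "inverse (real (Suc i)) \<le> inverse (real (Suc N))"
      "inverse (real (Suc j)) \<le> inverse (real (Suc N))"
      using that by (simp_all add: field_simps)
    with eV[of i] eV[of j]
    have "V (e i) \<le> m + inverse (real (Suc N))" "V (e j) \<le> m + inverse (real (Suc N))"
      by linarith+
    moreover have "m \<le> V ((1 - 1/2) *\<^sub>R e i + (1/2) *\<^sub>R e j)"
      by (intro m_le comb_in eE) auto
    ultimately show ?thesis
      unfolding V_comb by simp
  qed
  have "Cauchy (\<lambda>n. fst (e n))"
  proof (rule CauchyI)
    fix \<epsilon> :: real assume "\<epsilon> > 0"
    then have "\<epsilon>\<^sup>2 / 8 > 0" by simp
    then obtain N where N: "inverse (real (Suc N)) < \<epsilon>\<^sup>2 / 8"
      using reals_Archimedean by blast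
    have "norm (fst (e i) - fst (e j)) < \<epsilon>" if "N \<le> i" "N \<le> j" for i j
    proof -
      have "(norm (fst (e i) - fst (e j)))\<^sup>2 < \<epsilon>\<^sup>2"
        using dist_sq[OF that(2,1)] N by linarith
      then show ?thesis using \<open>\<epsilon> > 0\<close> by (simp add: power_less_imp_less_base)
    qed
    then show "\<exists>M. \<forall>i\<ge>M. \<forall>j\<ge>M. norm (fst (e i) - fst (e j)) < \<epsilon>" by blast
  qed
  then obtain p where p: "(\<lambda>n. fst (e n)) \<longlonglongrightarrow> p"
    by (auto simp: Cauchy_convergent_iff convergent_def)
  have "(\<lambda>n. V (e n)) \<longlonglongrightarrow> m"
  proof (rule tendsto_sandwich[of "\<lambda>_. m" _ _ "\<lambda>n. m + inverse (real (Suc n))"])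
    show "(\<lambda>n. m + inverse (real (Suc n))) \<longlonglongrightarrow> m"
      using tendsto_add[OF tendsto_const LIMSEQ_inverse_real_of_nat, of m] by simp
    show "\<forall>\<^sub>F n in sequentially. V (e n) \<le> m + inverse (real (Suc n))"
      using eV by (intro always_eventually allI less_imp_le)
    show "\<forall>\<^sub>F n in sequentially. m \<le> V (e n)"
      using m_le[OF eE] by (intro always_eventually allI)
  qed simp
  then have "(\<lambda>n. V (e n) - (norm (fst (e n)))\<^sup>2 / 2) \<longlonglongrightarrow> m - (norm p)\<^sup>2 / 2"
    by (intro tendsto_intros p) simp_all
  then have "(\<lambda>n. snd (e n)) \<longlonglongrightarrow> m - (norm p)\<^sup>2 / 2"
    by (simp add: V_def)
  from tendsto_Pair[OF p this] have "e \<longlonglongrightarrow> (p, m - (norm p)\<^sup>2 / 2)"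
    by simp
  with \<open>closed E\<close> eE have pE: "(p, m - (norm p)\<^sup>2 / 2) \<in> E"
    by (rule closed_sequentially)
  moreover have "m - (norm p)\<^sup>2 / 2 + (norm p)\<^sup>2 / 2 + (norm (q - p))\<^sup>2 / 2 \<le> t + (norm q)\<^sup>2 / 2"
    if qE: "(q, t) \<in> E" for q t
  proof -
    define D where "D = (norm (q - p))\<^sup>2 / 2"
    (* Comparing with points of the segment towards q and dividing by u gives the growth
       estimate up to the factor 1 - u, which then tends to 1. *)
    have ineq: "(1 - u) * D \<le> V (q, t) - m" if "0 < u" "u \<le> 1" for u
    proof -
      have "m \<le> V ((1 - u) *\<^sub>R (p, m - (norm p)\<^sup>2 / 2) + u *\<^sub>R (q, t))"
        using that by (intro m_le comb_in pE qE) auto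
      also have "\<dots> = m + u * (V (q, t) - m - (1 - u) * D)"
        unfolding V_comb by (simp add: V_def D_def field_simps)
      finally have "0 \<le> u * (V (q, t) - m - (1 - u) * D)" by simp
      with \<open>0 < u\<close> show ?thesis by (simp add: zero_le_mult_iff)
    qed
    have "((\<lambda>u. (1 - u) * D) \<longlongrightarrow> (1 - 0) * D) (at_right 0)"
      by (intro tendsto_intros)
    moreover have "\<forall>\<^sub>F u in at_right (0::real). (1 - u) * D \<le> V (q, t) - m"
      unfolding eventually_at_right_field using ineq by (intro exI[of _ 1]) auto
    ultimately have "(1 - 0) * D \<le> V (q, t) - m"
      by (rule tendsto_upperbound) simp
    then show ?thesis by (simp add: V_def D_def)
  qed
  ultimately show thesis by (rule that)
qed

section \<open>Minty's theorem\<close>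

text \<open>
  Here \<open>E\<close> is the epigraph of the Fitzpatrick function
  \<open>F (x, x') = Sup {x \<bullet> b + a \<bullet> x' - a \<bullet> b | (a, b) \<in> G}\<close>. Monotonicity gives
  \<open>F (a, b) \<le> a \<bullet> b\<close> on \<open>G\<close>, and maximality gives \<open>F (x, x') \<ge> x \<bullet> x'\<close> everywhere. Comparing the minimiser
  \<open>(x, x')\<close> with the points of \<open>G\<close> shows that \<open>(- x', - x)\<close> is related to all of \<open>G\<close>
  with a surplus of \<open>(norm (x + x'))\<^sup>2\<close>. Hence it lies in \<open>G\<close>, and it can be compared with itself.
\<close>

lemma maximal_monotone_graph_has_antidiagonal_point:
  fixes G :: "('a::{real_inner, complete_space} \<times> 'a) set"
  assumes mono: "\<And>a b c d. (a, b) \<in> G \<Longrightarrow> (c, d) \<in> G \<Longrightarrow> 0 \<le> (b - d) \<bullet> (a - c)"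
    and maxi: "\<And>u v. (\<And>a b. (a, b) \<in> G \<Longrightarrow> 0 \<le> (v - b) \<bullet> (u - a)) \<Longrightarrow> (u, v) \<in> G"
  obtains x where "(x, - x) \<in> G"
proof -
  have "G \<noteq> {}" using maxi by blast
  then obtain a0 b0 where G0: "(a0, b0) \<in> G" by auto
  define E where "E = {((x, x'), s). \<forall>(a, b) \<in> G. x \<bullet> b + a \<bullet> x' - a \<bullet> b \<le> s}"
  have E_half: "E = (\<Inter>(a, b) \<in> G. {e. ((b, a), - 1) \<bullet> e \<le> a \<bullet> b})"
    unfolding E_def by (fastforce simp: inner_commute algebra_simps)
  have "closed E" "convex E"
    unfolding E_half by (auto intro!: closed_INT convex_INT closed_halfspace_le convex_halfspace_le)
  have in_E: "((c, d), c \<bullet> d) \<in> E" if "(c, d) \<in> G" for c d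
    unfolding E_def using mono[OF _ that]
    by (fastforce simp: inner_diff_left inner_diff_right inner_commute)
  have above: "x \<bullet> x' \<le> s" if "((x, x'), s) \<in> E" for x x' s
  proof (rule ccontr)
    assume "\<not> x \<bullet> x' \<le> s"
    moreover have le: "x \<bullet> b + a \<bullet> x' - a \<bullet> b \<le> s" if "(a, b) \<in> G" for a b
      using \<open>((x, x'), s) \<in> E\<close> that unfolding E_def by blast
    ultimately have "0 \<le> (x' - b) \<bullet> (x - a)" if "(a, b) \<in> G" for a b
      using le[OF that] by (simp add: inner_diff_left inner_diff_right inner_commute)
    then have "(x, x') \<in> G" by (rule maxi)
    from le[OF this] \<open>\<not> x \<bullet> x' \<le> s\<close> show False by simp
  qed
  (* One affine minorant of the Fitzpatrick function bounds the objective below. *)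
  have low: "- (a0 \<bullet> b0) - (norm (b0, a0))\<^sup>2 / 2 \<le> t + (norm q)\<^sup>2 / 2" if "(q, t) \<in> E" for q t
  proof -
    have "(b0, a0) \<bullet> q - a0 \<bullet> b0 \<le> t"
      using that G0 unfolding E_def by (fastforce simp: inner_commute)
    moreover have "0 \<le> (norm (q + (b0, a0)))\<^sup>2" by simp
    then have "0 \<le> (norm q)\<^sup>2 + 2 * ((b0, a0) \<bullet> q) + (norm (b0, a0))\<^sup>2"
      unfolding power2_norm_eq_inner inner_add_left inner_add_right
      using inner_commute[of q "(b0, a0)"] by linarith
    ultimately show ?thesis by linarith
  qed
  have "E \<noteq> {}" using in_E[OF G0] by blast
  obtain p s where pE: "(p, s) \<in> E"
    and opt: "\<And>q t. (q, t) \<in> E \<Longrightarrow> s + (norm p)\<^sup>2 / 2 + (norm (q - p))\<^sup>2 / 2 \<le> t + (norm q)\<^sup>2 / 2"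
    using proximal_minimiser_exists[OF \<open>closed E\<close> \<open>convex E\<close> \<open>E \<noteq> {}\<close> low] by blast
  obtain x x' where p: "p = (x, x')" by (cases p)
  have surplus: "(norm (x + x'))\<^sup>2 \<le> (- x - b) \<bullet> (- x' - a)" if "(a, b) \<in> G" for a b
  proof -
    have "s + (norm p)\<^sup>2 / 2 + (norm ((a, b) - p))\<^sup>2 / 2 \<le> a \<bullet> b + (norm (a, b))\<^sup>2 / 2"
      using opt[OF in_E[OF that]] .
    then have "s + x \<bullet> x + x' \<bullet> x' \<le> a \<bullet> b + x \<bullet> a + x' \<bullet> b"
      unfolding p power2_norm_eq_inner
      by (simp add: inner_diff_left inner_diff_right inner_commute field_simps)
    moreover have "x \<bullet> x' \<le> s" using above pE p by blast
    ultimately show ?thesis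
      unfolding power2_norm_eq_inner
      by (simp add: inner_diff_left inner_diff_right inner_add_left inner_add_right inner_commute)
  qed
  have "(- x', - x) \<in> G"
    using surplus by (intro maxi) (meson order_trans zero_le_power2)
  moreover from surplus[OF this] have "- x' = x"
    by (simp add: add_eq_0_iff)
  ultimately show thesis using that by simp
qed

lemma monotone_mapping_iff:
  "monotone_mapping T \<longleftrightarrow> (\<forall>a b c d. b \<in> T a \<longrightarrow> d \<in> T c \<longrightarrow> 0 \<le> (b - d) \<bullet> (a - c))"
  by (auto simp: monotone_mapping_def gph_def)

lemma maximal_monotone_monoD:
  assumes "maximal_monotone T" "b \<in> T a" "d \<in> T c"
  shows "0 \<le> (b - d) \<bullet> (a - c)"
  using assms by (simp add: maximal_monotone_def monotone_mapping_iff)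

text \<open>
  If \<open>(u, v)\<close> is monotonically related to the whole graph, then adding this one point to the graph
  keeps the mapping monotone, so that maximality forces the point to be there already.
\<close>

lemma maximal_monotoneD:
  assumes "maximal_monotone T" and "\<And>a b. b \<in> T a \<Longrightarrow> 0 \<le> (v - b) \<bullet> (u - a)"
  shows "v \<in> T u"
proof -
  define S where "S = T(u := insert v (T u))"
  have gS: "gph S = insert (u, v) (gph T)"
    unfolding S_def gph_def by (auto split: if_splits)
  have "monotone_mapping S"
    unfolding monotone_mapping_def gS
  proof clarify
    fix a b c d assume *: "(a, b) \<in> insert (u, v) (gph T)" "(c, d) \<in> insert (u, v) (gph T)"
    have flip: "(b - v) \<bullet> (a - u) = (v - b) \<bullet> (u - a)" for a b
      by (metis inner_minus_left inner_minus_right minus_diff_eq)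
    from * consider "a = u" "b = v" "c = u" "d = v" | "a = u" "b = v" "d \<in> T c"
      | "b \<in> T a" "c = u" "d = v" | "b \<in> T a" "d \<in> T c"
      by (auto simp: gph_def)
    then show "0 \<le> (b - d) \<bullet> (a - c)"
      by cases (use assms(2) flip maximal_monotone_monoD[OF assms(1)] in auto)
  qed
  then have "gph T = gph S"
    using assms(1) gS unfolding maximal_monotone_def by blast
  then show ?thesis using gS by (auto simp: gph_def)
qed

text \<open>
  An affine change of the second coordinate turns the equation \<open>l x + y = z\<close> into \<open>x + y = 0\<close> and
  preserves maximal monotonicity.
\<close>

theorem minty_surjectivity:
  fixes T :: "'a::{real_inner, complete_space} \<Rightarrow> 'a set"
  assumes T: "maximal_monotone T" and "l > 0"
  obtains x y where "y \<in> T x" "l *\<^sub>R x + y = z"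
proof -
  define G where "G = {(a, b). z + l *\<^sub>R b \<in> T a}"
  obtain x where "(x, - x) \<in> G"
  proof (rule maximal_monotone_graph_has_antidiagonal_point)
    fix a b c d assume "(a, b) \<in> G" "(c, d) \<in> G"
    then have "0 \<le> (z + l *\<^sub>R b - (z + l *\<^sub>R d)) \<bullet> (a - c)"
      unfolding G_def by (intro maximal_monotone_monoD[OF T]) auto
    also have "\<dots> = l * ((b - d) \<bullet> (a - c))"
      by (simp add: scaleR_diff_right[symmetric])
    finally show "0 \<le> (b - d) \<bullet> (a - c)"
      using \<open>l > 0\<close> by (simp add: zero_le_mult_iff)
  next
    fix u v assume rel: "\<And>a b. (a, b) \<in> G \<Longrightarrow> 0 \<le> (v - b) \<bullet> (u - a)"
    have "z + l *\<^sub>R v \<in> T u"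
    proof (rule maximal_monotoneD[OF T])
      fix a b assume "b \<in> T a"
      then have "(a, (b - z) /\<^sub>R l) \<in> G"
        using \<open>l > 0\<close> by (simp add: G_def)
      from mult_nonneg_nonneg[OF less_imp_le[OF \<open>l > 0\<close>] rel[OF this]]
      have "0 \<le> (l *\<^sub>R (v - (b - z) /\<^sub>R l)) \<bullet> (u - a)" by simp
      also have "l *\<^sub>R (v - (b - z) /\<^sub>R l) = z + l *\<^sub>R v - b"
        using \<open>l > 0\<close> by (simp add: scaleR_diff_right)
      finally show "0 \<le> (z + l *\<^sub>R v - b) \<bullet> (u - a)" .
    qed
    then show "(u, v) \<in> G" by (simp add: G_def)
  qed blast
  then have "z + l *\<^sub>R (- x) \<in> T x" by (simp add: G_def)
  then show thesis by (rule that) simp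
qed

section \<open>The Cayley transform and nonexpansive maps\<close>

lemma norm_cayley_le_iff:
  fixes x y :: "'a::real_inner"
  assumes "l > 0"
  shows "norm (l *\<^sub>R x - y) \<le> norm (l *\<^sub>R x + y) \<longleftrightarrow> 0 \<le> y \<bullet> x"
proof -
  have "norm (l *\<^sub>R x - y) \<le> norm (l *\<^sub>R x + y) \<longleftrightarrow> 0 \<le> 4 * l * (y \<bullet> x)"
    unfolding norm_le by (simp add: inner_diff_left inner_diff_right inner_add_left
        inner_add_right inner_commute algebra_simps)
  with assms show ?thesis by (simp add: zero_le_mult_iff)
qed

text \<open>
  Along the segment from \<open>u\<close> to \<open>v\<close>, the set of parameters at which the estimate from \<open>u\<close> holds is
  closed, and its supremum can be pushed forward by the local estimate unless it is the endpoint.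
\<close>

lemma locally_nonexpansive_imp_nonexpansive:
  fixes f :: "'a::real_normed_vector \<Rightarrow> 'b::real_normed_vector"
  assumes loc: "\<And>w. \<exists>d>0. \<forall>z1\<in>ball w d. \<forall>z2\<in>ball w d. norm (f z1 - f z2) \<le> norm (z1 - z2)"
  shows "norm (f v - f u) \<le> norm (v - u)"
proof -
  have cont: "continuous_on UNIV f"
    unfolding continuous_on_iff
  proof (intro ballI allI impI)
    fix w and \<epsilon> :: real assume "\<epsilon> > 0"
    obtain d where "d > 0" and d: "\<forall>z1\<in>ball w d. \<forall>z2\<in>ball w d. norm (f z1 - f z2) \<le> norm (z1 - z2)"
      using loc by blast
    have "dist (f z) (f w) < \<epsilon>" if "dist z w < min d \<epsilon>" for z
    proof -
      have "norm (f z - f w) \<le> norm (z - w)"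
        using d that \<open>d > 0\<close> by (auto simp: dist_commute)
      with that show ?thesis by (simp add: dist_norm)
    qed
    then show "\<exists>\<delta>>0. \<forall>z\<in>UNIV. dist z w < \<delta> \<longrightarrow> dist (f z) (f w) < \<epsilon>"
      using \<open>d > 0\<close> \<open>\<epsilon> > 0\<close> by (intro exI[of _ "min d \<epsilon>"]) auto
  qed
  define g where "g = (\<lambda>t::real. u + t *\<^sub>R (v - u))"
  have g_diff: "g s - g t = (s - t) *\<^sub>R (v - u)" for s t
    by (simp add: g_def algebra_simps)
  define S where "S = {t \<in> {0..1}. norm (f (g t) - f u) \<le> t * norm (v - u)}"
  have cont_g: "continuous_on A g" for A
    unfolding g_def by (intro continuous_intros)
  have "closed S"
    unfolding S_def
    by (intro continuous_on_closed_Collect_le continuous_intros cont_g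
        continuous_on_compose2[OF cont]) auto
  have S01: "S \<subseteq> {0..1}" unfolding S_def by blast
  have bdd: "bdd_above S" using bdd_above_mono[OF bdd_above_Icc S01] .
  have "0 \<in> S" unfolding S_def by (simp add: g_def)
  define t where "t = Sup S"
  have tS: "t \<in> S"
    unfolding t_def using \<open>0 \<in> S\<close> bdd \<open>closed S\<close>
    by (intro closed_contains_Sup) auto
  have "t = 1"
  proof (rule ccontr)
    assume "t \<noteq> 1"
    with tS S01 have "t < 1" "0 \<le> t" by auto
    obtain d where "d > 0"
      and d: "\<forall>z1\<in>ball (g t) d. \<forall>z2\<in>ball (g t) d. norm (f z1 - f z2) \<le> norm (z1 - z2)"
      using loc by blast
    define h where "h = min (1 - t) (d / (norm (v - u) + 1))"
    have h: "0 < h" "t + h \<le> 1"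
      using \<open>t < 1\<close> \<open>d > 0\<close> by (auto simp: h_def add_nonneg_pos)
    have "h * norm (v - u) < h * (norm (v - u) + 1)" using h by simp
    also have "\<dots> \<le> d / (norm (v - u) + 1) * (norm (v - u) + 1)"
      unfolding h_def by (intro mult_right_mono) auto
    also have "\<dots> = d"
      by (metis add_nonneg_pos less_irrefl nonzero_eq_divide_eq norm_ge_zero zero_less_one)
    finally have "h * norm (v - u) < d" .
    moreover have step: "norm (g (t + h) - g t) = h * norm (v - u)"
      unfolding g_diff using h by simp
    ultimately have "g (t + h) \<in> ball (g t) d"
      by (simp add: dist_norm norm_minus_commute)
    with d \<open>d > 0\<close> have "norm (f (g (t + h)) - f (g t)) \<le> h * norm (v - u)"
      using step by (metis centre_in_ball)
    moreover have "norm (f (g t) - f u) \<le> t * norm (v - u)"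
      using tS by (simp add: S_def)
    ultimately have "norm (f (g (t + h)) - f u) \<le> (t + h) * norm (v - u)"
      using norm_triangle_ineq[of "f (g (t + h)) - f (g t)" "f (g t) - f u"]
      by (simp add: distrib_right)
    then have "t + h \<in> S" using h \<open>0 \<le> t\<close> by (simp add: S_def)
    then have "t + h \<le> t" unfolding t_def using bdd by (rule cSup_upper)
    with h show False by simp
  qed
  with tS show ?thesis by (simp add: S_def g_def)
qed

section \<open>Hypomonotone mappings with closed graph\<close>

lemma hypomonotone_resolvent_lipschitz:
  fixes x1 x2 y1 y2 :: "'a::real_inner"
  assumes "- r * (norm (x1 - x2))\<^sup>2 \<le> (y1 - y2) \<bullet> (x1 - x2)"
  shows "norm (x1 - x2) \<le> norm (((r + 1) *\<^sub>R x1 + y1) - ((r + 1) *\<^sub>R x2 + y2))"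
proof -
  define z where "z = ((r + 1) *\<^sub>R x1 + y1) - ((r + 1) *\<^sub>R x2 + y2)"
  have "z = (r + 1) *\<^sub>R (x1 - x2) + (y1 - y2)"
    by (simp add: z_def algebra_simps)
  then have "z \<bullet> (x1 - x2) = (r + 1) * (norm (x1 - x2))\<^sup>2 + (y1 - y2) \<bullet> (x1 - x2)"
    by (simp add: inner_add_left power2_norm_eq_inner)
  with assms have "(norm (x1 - x2))\<^sup>2 \<le> z \<bullet> (x1 - x2)"
    by (simp add: algebra_simps)
  also have "\<dots> \<le> norm z * norm (x1 - x2)"
    by (rule norm_cauchy_schwarz)
  finally have "norm (x1 - x2) * norm (x1 - x2) \<le> norm z * norm (x1 - x2)"
    by (simp add: power2_eq_square)
  then show ?thesis
    unfolding z_def[symmetric] by (cases "x1 = x2") auto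
qed

lemma resolvent_domain_closed:
  fixes T :: "'a::{real_inner, complete_space} \<Rightarrow> 'a set"
  assumes "closed (gph T)"
    and lip: "\<And>x1 y1 x2 y2. y1 \<in> T x1 \<Longrightarrow> y2 \<in> T x2 \<Longrightarrow>
      norm (x1 - x2) \<le> norm ((l *\<^sub>R x1 + y1) - (l *\<^sub>R x2 + y2))"
  shows "closed {z. \<exists>x. z - l *\<^sub>R x \<in> T x}"
  unfolding closed_sequential_limits
proof (intro allI impI, elim conjE)
  fix zs z assume "\<forall>n. zs n \<in> {z. \<exists>x. z - l *\<^sub>R x \<in> T x}" and z: "zs \<longlonglongrightarrow> z"
  then have "\<forall>n. \<exists>x. zs n - l *\<^sub>R x \<in> T x" by simp
  then obtain xs where xs: "\<And>n. zs n - l *\<^sub>R xs n \<in> T (xs n)"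
    using choice[of "\<lambda>n x. zs n - l *\<^sub>R x \<in> T x"] by blast
  have "Cauchy xs"
  proof (rule CauchyI)
    fix \<epsilon> :: real assume "\<epsilon> > 0"
    moreover have "Cauchy zs" using z by (rule LIMSEQ_imp_Cauchy)
    ultimately obtain M where M: "\<forall>m\<ge>M. \<forall>n\<ge>M. norm (zs m - zs n) < \<epsilon>"
      using CauchyD by blast
    have "norm (xs m - xs n) \<le> norm (zs m - zs n)" for m n
      using lip[OF xs[of m] xs[of n]] by simp
    with M show "\<exists>M. \<forall>m\<ge>M. \<forall>n\<ge>M. norm (xs m - xs n) < \<epsilon>"
      by (meson le_less_trans)
  qed
  then obtain x where x: "xs \<longlonglongrightarrow> x"
    by (auto simp: Cauchy_convergent_iff convergent_def)
  have "(x, z - l *\<^sub>R x) \<in> gph T"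
  proof (rule closed_sequentially[OF \<open>closed (gph T)\<close>])
    show "(xs n, zs n - l *\<^sub>R xs n) \<in> gph T" for n using xs by (simp add: gph_def)
    show "(\<lambda>n. (xs n, zs n - l *\<^sub>R xs n)) \<longlonglongrightarrow> (x, z - l *\<^sub>R x)"
      by (intro tendsto_intros x z)
  qed
  then show "z \<in> {z. \<exists>x. z - l *\<^sub>R x \<in> T x}" by (auto simp: gph_def)
qed

text \<open>
  The resolvent of the maximal monotone mapping that agrees with \<open>T\<close> near \<open>(x, y)\<close> is defined
  everywhere and Lipschitz, so for \<open>z\<close> close to \<open>l x + y\<close> its values stay in the region of agreement
  and are graph points of \<open>T\<close>.
\<close>

lemma locally_maximal_monotone_resolvent:
  fixes T :: "'a::{real_inner, complete_space} \<Rightarrow> 'a set"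
  assumes "locally_maximal_monotone_around T (x, y)" "l > 0"
  shows "\<exists>d>0. \<exists>J. (\<forall>z\<in>ball (l *\<^sub>R x + y) d. z - l *\<^sub>R J z \<in> T (J z))
    \<and> (\<forall>z1 z2. 0 \<le> ((z1 - l *\<^sub>R J z1) - (z2 - l *\<^sub>R J z2)) \<bullet> (J z1 - J z2))"
proof -
  obtain S W where S: "maximal_monotone S" and W: "(x, y) \<in> interior W"
    and SW: "gph S \<inter> W = gph T \<inter> W" and xyT: "(x, y) \<in> gph T"
    using assms unfolding locally_maximal_monotone_around_def by blast
  have yS: "y \<in> S x" using SW xyT W interior_subset[of W] by (auto simp: gph_def)
  have "\<exists>x'. z - l *\<^sub>R x' \<in> S x'" for z
  proof -
    obtain x' y' where "y' \<in> S x'" "l *\<^sub>R x' + y' = z"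
      using minty_surjectivity[OF S \<open>l > 0\<close>] by blast
    then have "z - l *\<^sub>R x' \<in> S x'" by auto
    then show ?thesis ..
  qed
  then obtain J where J: "\<And>z. z - l *\<^sub>R J z \<in> S (J z)"
    using choice[of "\<lambda>z x'. z - l *\<^sub>R x' \<in> S x'"] by blast
  obtain e where "e > 0" and e: "ball (x, y) e \<subseteq> W"
    using W mem_interior by blast
  define d where "d = e / (1 / l + 2)"
  have "d > 0" using \<open>e > 0\<close> \<open>l > 0\<close> by (simp add: d_def add_pos_pos)
  moreover have "z - l *\<^sub>R J z \<in> T (J z)" if "z \<in> ball (l *\<^sub>R x + y) d" for z
  proof -
    define D where "D = norm (z - (l *\<^sub>R x + y))"
    have split: "(z - l *\<^sub>R J z) - y = (z - (l *\<^sub>R x + y)) - l *\<^sub>R (J z - x)"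
      by (simp add: algebra_simps)
    have "0 \<le> ((z - l *\<^sub>R J z) - y) \<bullet> (J z - x)"
      using J yS by (rule maximal_monotone_monoD[OF S])
    then have "l * (norm (J z - x))\<^sup>2 \<le> (z - (l *\<^sub>R x + y)) \<bullet> (J z - x)"
      unfolding split by (simp add: inner_diff_left[of _ "l *\<^sub>R (J z - x)"] power2_norm_eq_inner)
    also have "\<dots> \<le> D * norm (J z - x)"
      unfolding D_def by (rule norm_cauchy_schwarz)
    finally have lD: "l * norm (J z - x) \<le> D"
      by (cases "J z = x") (auto simp: power2_eq_square D_def)
    then have 1: "norm (J z - x) \<le> D / l"
      using \<open>l > 0\<close> by (simp add: field_simps)
    have "norm ((z - l *\<^sub>R J z) - y) \<le> D + norm (l *\<^sub>R (J z - x))"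
      unfolding D_def split by (rule norm_triangle_ineq4)
    with lD \<open>l > 0\<close> have 2: "norm ((z - l *\<^sub>R J z) - y) \<le> 2 * D" by simp
    have "dist (J z, z - l *\<^sub>R J z) (x, y) \<le> norm (J z - x) + norm ((z - l *\<^sub>R J z) - y)"
      by (simp add: dist_norm norm_Pair sqrt_sum_squares_le_sum)
    also have "\<dots> \<le> D * (1 / l + 2)" using 1 2 by (simp add: algebra_simps)
    also have "\<dots> < d * (1 / l + 2)"
      using that \<open>l > 0\<close> by (intro mult_strict_right_mono)
        (auto simp: D_def dist_norm norm_minus_commute add_pos_pos)
    also have "\<dots> = e"
    proof -
      have "1 / l + 2 > 0" using \<open>l > 0\<close> by (simp add: add_pos_pos)
      then show ?thesis by (simp add: d_def)
    qed
    finally have "(J z, z - l *\<^sub>R J z) \<in> W" using e by (auto simp: dist_commute)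
    with SW J[of z] show ?thesis by (auto simp: gph_def)
  qed
  moreover have "0 \<le> ((z - l *\<^sub>R J z) - (w - l *\<^sub>R J w)) \<bullet> (J z - J w)" for z w
    using J J by (rule maximal_monotone_monoD[OF S])
  ultimately show ?thesis by (intro exI[of _ d] exI[of _ J] conjI ballI allI)
qed

lemma monotone_surjective_imp_maximal_monotone:
  assumes mono: "monotone_mapping T" and "l > 0"
    and surj: "\<And>z. \<exists>x. z - l *\<^sub>R x \<in> T x"
  shows "maximal_monotone T"
  unfolding maximal_monotone_def
proof (intro conjI allI impI mono, elim conjE)
  fix S assume S: "monotone_mapping S" and TS: "gph T \<subseteq> gph S"
  have "(u, v) \<in> gph T" if uv: "(u, v) \<in> gph S" for u v
  proof -
    obtain x where x: "(l *\<^sub>R u + v) - l *\<^sub>R x \<in> T x" using surj by blast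
    then have "(l *\<^sub>R u + v) - l *\<^sub>R x \<in> S x" "v \<in> S u"
      using TS uv by (auto simp: gph_def)
    with S have "0 \<le> (v - ((l *\<^sub>R u + v) - l *\<^sub>R x)) \<bullet> (u - x)"
      by (simp only: monotone_mapping_iff)
    also have "v - ((l *\<^sub>R u + v) - l *\<^sub>R x) = - l *\<^sub>R (u - x)" by (simp add: algebra_simps)
    finally have "l * ((u - x) \<bullet> (u - x)) \<le> 0" by simp
    with \<open>l > 0\<close> have "(u - x) \<bullet> (u - x) \<le> 0" by (simp add: mult_le_0_iff)
    then have "u = x" by (metis inner_eq_zero_iff inner_ge_zero order_antisym right_minus_eq)
    with x show ?thesis by (simp add: gph_def)
  qed
  with TS show "gph T = gph S" by auto
qed

section \<open>Local and global maximal monotonicity\<close>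

theorem theorem6p3:
  fixes T :: "'a::{real_inner, complete_space} \<Rightarrow> 'a set"
  assumes "proper_mapping T"
    and "hypomonotone T"
    and "closed (gph T)"
  shows "maximal_monotone T \<longleftrightarrow> (\<forall>p \<in> gph T. locally_maximal_monotone_around T p)"
proof
  assume "maximal_monotone T"
  then show "\<forall>p \<in> gph T. locally_maximal_monotone_around T p"
    unfolding locally_maximal_monotone_around_def
    by (metis UNIV_I interior_UNIV)
next
  assume loc: "\<forall>p \<in> gph T. locally_maximal_monotone_around T p"
  obtain r where "r > 0" and r: "\<And>x1 y1 x2 y2. y1 \<in> T x1 \<Longrightarrow> y2 \<in> T x2 \<Longrightarrow>
      - r * (norm (x1 - x2))\<^sup>2 \<le> (y1 - y2) \<bullet> (x1 - x2)"
    using \<open>hypomonotone T\<close> by (auto simp: hypomonotone_def gph_def)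
  (* The shift by r + 1 makes the resolvent Lipschitz with constant 1 / (l - r) = 1. *)
  define l where "l = r + 1"
  have "l > 0" using \<open>r > 0\<close> by (simp add: l_def)
  have lip: "norm (x1 - x2) \<le> norm ((l *\<^sub>R x1 + y1) - (l *\<^sub>R x2 + y2))"
    if "y1 \<in> T x1" "y2 \<in> T x2" for x1 y1 x2 y2
    unfolding l_def by (rule hypomonotone_resolvent_lipschitz[OF r[OF that]])
  have uniq: "x1 = x2" if "z - l *\<^sub>R x1 \<in> T x1" "z - l *\<^sub>R x2 \<in> T x2" for z x1 x2
    using lip[OF that] by simp
  define R where "R = {z. \<exists>x. z - l *\<^sub>R x \<in> T x}"
  have "closed R"
    unfolding R_def using \<open>closed (gph T)\<close> lip by (rule resolvent_domain_closed)
  have near: "\<exists>d>0. \<exists>J. (\<forall>z\<in>ball w d. z - l *\<^sub>R J z \<in> T (J z))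
      \<and> (\<forall>z1 z2. 0 \<le> ((z1 - l *\<^sub>R J z1) - (z2 - l *\<^sub>R J z2)) \<bullet> (J z1 - J z2))" if "w \<in> R" for w
  proof -
    obtain x where "w - l *\<^sub>R x \<in> T x" using \<open>w \<in> R\<close> by (auto simp: R_def)
    then have "locally_maximal_monotone_around T (x, w - l *\<^sub>R x)"
      using loc by (simp add: gph_def)
    from locally_maximal_monotone_resolvent[OF this \<open>l > 0\<close>] show ?thesis
      by (simp only: add_diff_cancel_left' diff_add_cancel add.commute[of "l *\<^sub>R x"])
  qed
  have "open R"
    unfolding open_contains_ball
  proof
    fix w assume "w \<in> R"
    with near show "\<exists>d>0. ball w d \<subseteq> R" unfolding R_def by blast
  qed
  moreover have "R \<noteq> {}"
  proof -
    obtain x y where "y \<in> T x"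
      using \<open>proper_mapping T\<close> by (auto simp: proper_mapping_def gph_def)
    then have "l *\<^sub>R x + y \<in> R" by (auto simp: R_def intro!: exI[of _ x])
    then show ?thesis by blast
  qed
  ultimately have "R = UNIV" using \<open>closed R\<close> clopen by blast
  then have surj: "\<exists>x. z - l *\<^sub>R x \<in> T x" for z by (auto simp: R_def)
  then obtain K where K: "\<And>z. z - l *\<^sub>R K z \<in> T (K z)"
    using choice[of "\<lambda>z x. z - l *\<^sub>R x \<in> T x"] by blast
  define N where "N = (\<lambda>z. l *\<^sub>R K z - (z - l *\<^sub>R K z))"
  have N_le_iff: "norm (N z1 - N z2) \<le> norm (z1 - z2)
      \<longleftrightarrow> 0 \<le> ((z1 - l *\<^sub>R K z1) - (z2 - l *\<^sub>R K z2)) \<bullet> (K z1 - K z2)" for z1 z2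
    using norm_cayley_le_iff[OF \<open>l > 0\<close>, of "K z1 - K z2" "(z1 - l *\<^sub>R K z1) - (z2 - l *\<^sub>R K z2)"]
    by (simp add: N_def algebra_simps)
  have nonexp: "norm (N z1 - N z2) \<le> norm (z1 - z2)" for z1 z2
  proof (rule locally_nonexpansive_imp_nonexpansive)
    fix w
    obtain d J where "d > 0" and JT: "\<forall>z\<in>ball w d. z - l *\<^sub>R J z \<in> T (J z)"
      and J: "\<forall>z1 z2. 0 \<le> ((z1 - l *\<^sub>R J z1) - (z2 - l *\<^sub>R J z2)) \<bullet> (J z1 - J z2)"
      using near[of w] \<open>R = UNIV\<close> by blast
    (* J comes from a maximal monotone mapping, hence it is monotone, and on the ball it
       coincides with the global resolvent K. *)
    have "K z = J z" if "z \<in> ball w d" for z using uniq K JT that by blast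
    then have "\<forall>z1\<in>ball w d. \<forall>z2\<in>ball w d. norm (N z1 - N z2) \<le> norm (z1 - z2)"
      unfolding N_le_iff using J by metis
    with \<open>d > 0\<close> show "\<exists>d>0. \<forall>z1\<in>ball w d. \<forall>z2\<in>ball w d. norm (N z1 - N z2) \<le> norm (z1 - z2)"
      by blast
  qed
  have K_graph: "K (l *\<^sub>R x + y) = x" if "y \<in> T x" for x y
    using uniq[OF K, of "l *\<^sub>R x + y" x] that by simp
  have "0 \<le> (y1 - y2) \<bullet> (x1 - x2)" if "y1 \<in> T x1" "y2 \<in> T x2" for x1 y1 x2 y2
    using nonexp[of "l *\<^sub>R x1 + y1" "l *\<^sub>R x2 + y2"]
    unfolding N_le_iff K_graph[OF that(1)] K_graph[OF that(2)] by simp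
  then have "monotone_mapping T"
    unfolding monotone_mapping_iff by blast
  then show "maximal_monotone T"
    using \<open>l > 0\<close> surj by (rule monotone_surjective_imp_maximal_monotone)
qed

end
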